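(* Let $C=\{x\in\mathbb{R}:\mu(\{x\})+\pi_{X=x}(D)=0\}$ and, for $\varepsilon>0$, let $D_\varepsilon=\{y\in\mathcal{Y}:\pi_{Y=y}((x_\varepsilon,x_\varepsilon+\varepsilon])=1\text{ for some }x_\varepsilon\in\mathbb{R}\}$. Assume that there exist $\varepsilon>0$, a diffuse probability measure $\eta$ on $\mathbb{R}$, and a subset $\mathcal{X}$ of $\mathbb{R}$ with at most countable closure, such that for $\nu$-almost every $y$ in the set $\{y\in D_\varepsilon\cap D^c:\pi_{Y=y}(C)=1\}$ at least one of the following holds: (i) the cumulative distribution function $F_{Y=y}$ of $\pi_{Y=y}$ is strictly increasing on some interval of positive length; (ii) there exists a probability measure $\gamma_y$ on $\mathbb{R}$ such that $\gamma_y\ll\pi_{Y=y}$ and $\gamma_y\ll\eta$; (iii) there exists $x\in\mathcal{X}$ such that $F_{Y=y}(x)\in(0,1)$. Then $\mu(C)>0$ implies that property $(\mathcal{R}_+)$ does not hold.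
   Context: Setting: $\mathcal{Y}$ is a separable Banach space with Borel $\sigma$-algebra $\mathcal{B}(\mathcal{Y})$, and $\pi$ is a probability measure on $\mathbb{R}\times\mathcal{Y}$ (with its Borel $\sigma$-algebra) with first marginal $\mu$ on $\mathbb{R}$ and second marginal $\nu$ on $\mathcal{Y}$. Fix probability kernels $(\pi_{X=x})_{x\in\mathbb{R}}$ (probability measures on $\mathcal{Y}$) and $(\pi_{Y=y})_{y\in\mathcal{Y}}$ (probability measures on $\mathbb{R}$) disintegrating $\pi$: $\pi(dx,dy)=\mu(dx)\,\pi_{X=x}(dy)=\nu(dy)\,\pi_{Y=y}(dx)$. $D$ is the Borel set $D=\{y\in\mathcal{Y}:\pi_{Y=y}\text{ is a Dirac mass}\}$, and $D^c$ is its complement in $\mathcal{Y}$. $L^1_+(\mu)$ denotes the set of non-negative elements of $L^1(\mu)$. A probability measure is diffuse if it has no atoms. Property $(\mathcal{R}_+)$: for every $f\in L^1_+(\mu)$ there exists a measurable $g:\mathcal{Y}\to\mathbb{R}_+=[0,\infty)$ such that $f(x)=\int_{\mathcal{Y}}g(y)\,\pi_{X=x}(dy)$ for $\mu$-a.e. $x$. *)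

theory Defs
  imports "HOL-Probability.Probability"
begin

definition disintegration ::
  "('a::topological_space \<times> 'b::topological_space) measure \<Rightarrow> ('a \<Rightarrow> 'b measure) \<Rightarrow> ('b \<Rightarrow> 'a measure) \<Rightarrow> bool"
  where
  "disintegration P KX KY \<longleftrightarrow>
     KX \<in> borel \<rightarrow>\<^sub>M prob_algebra borel \<and>
     KY \<in> borel \<rightarrow>\<^sub>M prob_algebra borel \<and>
     (\<forall>E\<in>sets borel.
        emeasure P E = (\<integral>\<^sup>+ x. emeasure (KX x) {y. (x, y) \<in> E} \<partial>distr P borel fst) \<and>
        emeasure P E = (\<integral>\<^sup>+ y. emeasure (KY y) {x. (x, y) \<in> E} \<partial>distr P borel snd))"

definition dirac_set :: "('b \<Rightarrow> real measure) \<Rightarrow> 'b set" where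
  "dirac_set KY = {y. \<exists>x. KY y = return borel x}"

definition C_set :: "real measure \<Rightarrow> (real \<Rightarrow> 'b measure) \<Rightarrow> ('b \<Rightarrow> real measure) \<Rightarrow> real set" where
  "C_set \<mu> KX KY = {x. emeasure \<mu> {x} + emeasure (KX x) (dirac_set KY) = 0}"

definition D_eps :: "('b \<Rightarrow> real measure) \<Rightarrow> real \<Rightarrow> 'b set" where
  "D_eps KY \<epsilon> = {y. \<exists>x. emeasure (KY y) {x<..x + \<epsilon>} = 1}"

text \<open>For Borel measures on the line, having no atoms means charging no singleton.\<close>

definition diffuse :: "real measure \<Rightarrow> bool" where
  "diffuse M \<longleftrightarrow> (\<forall>x. emeasure M {x} = 0)"

text \<open>An element of \<open>L\<^sup>1\<^sub>+(\<mu>)\<close> is given by a representative that is non-negative almost everywhere.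
  The integral of \<open>g\<close> is the Lebesgue integral with values in \<open>[0,\<infty>]\<close>: the Bochner integral
  would be \<open>0\<close> for a non-integrable \<open>g\<close>.\<close>

definition R_plus :: "real measure \<Rightarrow> (real \<Rightarrow> 'b::topological_space measure) \<Rightarrow> bool" where
  "R_plus \<mu> KX \<longleftrightarrow>
     (\<forall>f::real \<Rightarrow> real. integrable \<mu> f \<and> (AE x in \<mu>. 0 \<le> f x) \<longrightarrow>
        (\<exists>g::'b \<Rightarrow> real. g \<in> borel_measurable borel \<and> (\<forall>y. 0 \<le> g y) \<and>
           (AE x in \<mu>. ennreal (f x) = (\<integral>\<^sup>+ y. ennreal (g y) \<partial>KX x))))"

end

theory Submission
  imports Defs
begin

text \<open>If property \<open>(R\<^sub>+)\<close> holds and \<open>f\<close> is the indicator of a Borel set \<open>A\<close>, then the corresponding \<open>g\<close> lives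
  on \<open>{y. \<pi>\<^bsub>Y=y\<^esub>(A) = 1}\<close>. It is therefore enough to find \<open>A \<subseteq> C\<close> with \<open>\<mu>(A) > 0\<close> such that almost
  every such \<open>y\<close> is in \<open>D\<close>, because \<open>\<pi>\<^bsub>X=x\<^esub>(D) = 0\<close> for \<open>x \<in> C\<close>.
  By exhaustion and Fubini there is a countable set \<open>\<Xi>\<close> that meets the support of \<open>\<pi>\<^bsub>Y=y\<^esub>\<close> for
  almost every \<open>y\<close> for which \<open>\<eta>\<close> charges this support, which covers case (ii); adding the rationals
  covers case (i). As \<open>\<mu>\<close> has no atoms in \<open>C\<close>, there is an open \<open>U \<supseteq> \<Xi> \<union> \<rat>\<close> with
  \<open>\<mu>(C \<inter> U) < \<mu>(C)\<close>, and \<open>\<pi>\<^bsub>Y=y\<^esub>(U) > 0\<close> in cases (i) and (ii). So \<open>A\<close> can be taken to be the part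
  of \<open>C - U\<close> in an interval of length at most \<open>\<epsilon>\<close> that avoids \<open>X\<close>, which rules out case (iii).\<close>

text \<open>The union of the sections of \<open>H\<close> over a countable set is maximised by some countable \<open>\<Xi>\<close>, which
  then covers every section up to a null set.\<close>

lemma countable_transversal:
  fixes H :: "('a \<times> 'b) set"
  assumes sf: "sigma_finite_measure M" and fin: "finite_measure N"
    and H: "H \<in> sets (M \<Otimes>\<^sub>M N)"
  obtains \<Xi> where "countable \<Xi>" "\<Xi> \<subseteq> space M"
    and "AE y in N. emeasure M {x. (x, y) \<in> H} > 0 \<longrightarrow> (\<exists>x\<in>\<Xi>. (x, y) \<in> H)"
proof -
  interpret M: sigma_finite_measure M by fact
  interpret N: finite_measure N by fact
  interpret MN: pair_sigma_finite M N ..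
  define S where "S \<Xi> = (\<Union>x\<in>\<Xi>. {y. (x, y) \<in> H})" for \<Xi>
  define CS where "CS = {\<Xi>. countable \<Xi> \<and> \<Xi> \<subseteq> space M}"
  have sec: "{y. (x, y) \<in> H} \<in> sets N" for x
    using sets_Pair1[OF H, of x] by (simp add: vimage_def)
  have S_sets: "S \<Xi> \<in> sets N" if "\<Xi> \<in> CS" for \<Xi>
    using that sec unfolding S_def CS_def by (intro sets.countable_UN'') auto
  have "CS \<noteq> {}" unfolding CS_def by auto
  from ennreal_SUP_countable_SUP[OF this, of "\<lambda>\<Xi>. emeasure N (S \<Xi>)"]
  obtain f :: "nat \<Rightarrow> ennreal" where f: "range f \<subseteq> (\<lambda>\<Xi>. emeasure N (S \<Xi>)) ` CS"
    "(SUP \<Xi>\<in>CS. emeasure N (S \<Xi>)) = (SUP n. f n)" by auto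
  have "\<forall>n. \<exists>\<Xi>. \<Xi> \<in> CS \<and> f n = emeasure N (S \<Xi>)" using f(1) by blast
  then obtain X where X: "\<And>n. X n \<in> CS" "\<And>n. f n = emeasure N (S (X n))" by metis
  \<comment> \<open>Along a maximising sequence of countable sets, the union is still countable, so
    the supremum is attained.\<close>
  define \<Xi> where "\<Xi> = (\<Union>n. X n)"
  have \<Xi>: "\<Xi> \<in> CS" using X(1) unfolding \<Xi>_def CS_def by auto
  have "f n \<le> emeasure N (S \<Xi>)" for n
    unfolding X(2) by (rule emeasure_mono[OF _ S_sets[OF \<Xi>]]) (auto simp: S_def \<Xi>_def)
  then have "(SUP \<Xi>\<in>CS. emeasure N (S \<Xi>)) \<le> emeasure N (S \<Xi>)"
    unfolding f(2) by (rule SUP_least)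
  then have maximal: "emeasure N (S \<Xi>') \<le> emeasure N (S \<Xi>)" if "\<Xi>' \<in> CS" for \<Xi>'
    using that by (meson SUP_upper order_trans)
  have null: "AE y in N. \<not> ((x, y) \<in> H \<and> y \<notin> S \<Xi>)" if "x \<in> space M" for x
  proof -
    let ?T = "{y. (x, y) \<in> H} - S \<Xi>"
    have T: "?T \<in> sets N" using sec S_sets[OF \<Xi>] by blast
    \<comment> \<open>Adjoining one point cannot increase the maximal mass; since \<open>N\<close>
      is finite, that mass can be cancelled, so what \<open>x\<close> adds is null.\<close>
    have ins: "insert x \<Xi> \<in> CS" using \<Xi> that by (auto simp: CS_def)
    have "emeasure N (S \<Xi>) + emeasure N ?T = emeasure N (S \<Xi> \<union> ?T)"
      using T S_sets[OF \<Xi>] by (intro plus_emeasure) auto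
    also have "S \<Xi> \<union> ?T = S (insert x \<Xi>)" by (auto simp: S_def)
    also have "emeasure N \<dots> \<le> emeasure N (S \<Xi>)" by (rule maximal[OF ins])
    finally have "emeasure N (S \<Xi>) + emeasure N ?T \<le> emeasure N (S \<Xi>) + 0" by simp
    then have "emeasure N ?T \<le> 0"
      using N.emeasure_finite[of "S \<Xi>"] by (subst (asm) ennreal_add_left_cancel_le) auto
    then show ?thesis
      by (intro AE_I[of _ _ ?T]) (use T in auto)
  qed
  \<comment> \<open>The exceptional set of \<open>y\<close> depends on \<open>x\<close>. Fubini for
    null sets swaps the quantifiers, leaving for almost every \<open>y\<close> an
    \<open>M\<close>-null set of uncovered \<open>x\<close>.\<close>
  have "AE x in M. AE y in N. \<not> ((x, y) \<in> H \<and> y \<notin> S \<Xi>)"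
    using null by (rule AE_I2)
  moreover have "{p \<in> space (M \<Otimes>\<^sub>M N). \<not> ((fst p, snd p) \<in> H \<and> snd p \<notin> S \<Xi>)}
      \<in> sets (M \<Otimes>\<^sub>M N)"
    using H S_sets[OF \<Xi>] by measurable
  ultimately have "AE y in N. AE x in M. \<not> ((x, y) \<in> H \<and> y \<notin> S \<Xi>)"
    by (subst (asm) MN.AE_commute) auto
  then have "AE y in N. emeasure M {x. (x, y) \<in> H} > 0 \<longrightarrow> (\<exists>x\<in>\<Xi>. (x, y) \<in> H)"
  proof (rule AE_mp, intro AE_I2 impI)
    fix y assume y: "AE x in M. \<not> ((x, y) \<in> H \<and> y \<notin> S \<Xi>)"
      and pos: "emeasure M {x. (x, y) \<in> H} > 0"
    show "\<exists>x\<in>\<Xi>. (x, y) \<in> H"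
    proof (rule ccontr)
      assume "\<not> ?thesis"
      then have "y \<notin> S \<Xi>" by (auto simp: S_def)
      with y have "AE x in M. x \<notin> {x. (x, y) \<in> H}" by simp
      moreover have "{x. (x, y) \<in> H} \<in> sets M"
        using sets_Pair2[OF H, of y] by (simp add: vimage_def)
      ultimately have "emeasure M {x. (x, y) \<in> H} = 0"
        by (simp add: AE_iff_null_sets null_setsD1)
      with pos show False by simp
    qed
  qed
  then show ?thesis using that \<Xi> by (auto simp: CS_def)
qed

section \<open>Topological support of a measure and its joint measurability\<close>

definition support :: "'a::topological_space measure \<Rightarrow> 'a set" where
  "support M = {x. \<forall>U. open U \<and> x \<in> U \<longrightarrow> emeasure M U > 0}"

lemma closed_support: "closed (support M)"
proof -
  have "- support M = \<Union>{U. open U \<and> emeasure M U = 0}"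
    by (auto simp: support_def)
  then show ?thesis
    by (metis (mono_tags, lifting) closed_def mem_Collect_eq open_Union)
qed

text \<open>Every neighbourhood of \<open>x\<close> contains one of these balls. Countably many
  conditions replace all open sets, which makes the support accessible to measurability
  arguments.\<close>

lemma support_ball_iff:
  fixes M :: "'a::metric_space measure"
  assumes "sets M = sets borel"
  shows "x \<in> support M \<longleftrightarrow> (\<forall>n::nat. emeasure M (ball x (1 / real (Suc n))) > 0)"
proof (intro iffI allI)
  fix n :: nat assume "x \<in> support M"
  then show "emeasure M (ball x (1 / real (Suc n))) > 0" by (auto simp: support_def)
next
  assume *: "\<forall>n::nat. emeasure M (ball x (1 / real (Suc n))) > 0"
  show "x \<in> support M"
    unfolding support_def
  proof (intro CollectI allI impI)
    fix U assume U: "open U \<and> x \<in> U"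
    then obtain e where e: "e > 0" "ball x e \<subseteq> U" by (meson openE)
    obtain n where "inverse (real (Suc n)) < e" using reals_Archimedean[OF e(1)] by blast
    then have "1 / real (Suc n) \<le> e" by (simp add: inverse_eq_divide)
    then have "ball x (1 / real (Suc n)) \<subseteq> U" using e(2) subset_ball by blast
    then have "emeasure M (ball x (1 / real (Suc n))) \<le> emeasure M U"
      using U assms by (intro emeasure_mono) auto
    with * show "emeasure M U > 0" by (meson order_less_le_trans)
  qed
qed

text \<open>The complement is the union of all open null sets, and by Lindelof countably many of
  them suffice.\<close>

lemma emeasure_Compl_support:
  fixes M :: "'a::second_countable_topology measure"
  assumes "sets M = sets borel"
  shows "emeasure M (- support M) = 0"
proof -
  let ?F = "{U. open U \<and> emeasure M U = 0}"
  obtain F where F: "F \<subseteq> ?F" "countable F" "\<Union>F = \<Union>?F"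
    using Lindelof[of ?F] by auto
  have "- support M = \<Union>F" unfolding F(3) by (auto simp: support_def)
  moreover have "(\<Union>U\<in>F. U) \<in> null_sets M"
    by (intro null_sets_UN') (use F assms in \<open>auto dest!: subsetD simp: null_sets_def\<close>)
  ultimately show ?thesis by auto
qed

text \<open>The mass of a ball depends jointly measurably on its centre and on the kernel parameter.
  This makes the supports of a kernel the sections of one measurable set, as
  \<open>countable_transversal\<close> requires.\<close>

lemma sets_graph_support:
  fixes K :: "'b \<Rightarrow> 'a::{second_countable_topology, metric_space} measure"
  assumes [measurable]: "K \<in> N \<rightarrow>\<^sub>M subprob_algebra borel"
  shows "{p \<in> space (borel \<Otimes>\<^sub>M N). fst p \<in> support (K (snd p))} \<in> sets (borel \<Otimes>\<^sub>M N)"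
proof -
  have [measurable]: "(\<lambda>p. emeasure (K (snd p)) (ball (fst p) r)) \<in> borel_measurable (borel \<Otimes>\<^sub>M N)"
    for r :: real
  proof (rule emeasure_measurable_subprob_algebra2[where N=borel])
    have "(SIGMA p:space (borel \<Otimes>\<^sub>M N). ball (fst p :: 'a) r)
      = {q \<in> space ((borel \<Otimes>\<^sub>M N) \<Otimes>\<^sub>M borel). dist (fst (fst q)) (snd q) < r}"
      by (auto simp: space_pair_measure)
    also have "\<dots> \<in> sets ((borel \<Otimes>\<^sub>M N) \<Otimes>\<^sub>M borel)" by measurable
    finally show "(SIGMA p:space (borel \<Otimes>\<^sub>M N). ball (fst p) r) \<in> \<dots>" .
  qed measurable
  have "{p \<in> space (borel \<Otimes>\<^sub>M N). fst p \<in> support (K (snd p))} =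
      {p \<in> space (borel \<Otimes>\<^sub>M N). \<forall>n::nat. emeasure (K (snd p)) (ball (fst p) (1 / real (Suc n))) > 0}"
  proof (intro Collect_cong conj_cong refl)
    fix p :: "'a \<times> 'b" assume "p \<in> space (borel \<Otimes>\<^sub>M N)"
    then have "snd p \<in> space N" by (auto simp: space_pair_measure)
    then have "sets (K (snd p)) = sets borel"
      using subprob_measurableD(2)[OF assms] by simp
    then show "fst p \<in> support (K (snd p)) \<longleftrightarrow>
        (\<forall>n::nat. emeasure (K (snd p)) (ball (fst p) (1 / real (Suc n))) > 0)"
      by (rule support_ball_iff)
  qed
  also have "\<dots> \<in> sets (borel \<Otimes>\<^sub>M N)" by measurable
  finally show ?thesis .
qed

section \<open>Dirac laws and measurability of the Dirac set\<close>

lemma prob_eq_return_iff: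
  fixes M :: "'a::t1_space measure"
  assumes "prob_space M" and "sets M = sets borel"
  shows "M = return borel x \<longleftrightarrow> emeasure M (- {x}) = 0"
proof
  assume "M = return borel x"
  then show "emeasure M (- {x}) = 0" by simp
next
  interpret prob_space M by fact
  assume 0: "emeasure M (- {x}) = 0"
  then have null: "- {x} \<in> null_sets M" using assms(2) by auto
  then have AE: "AE y in M. y = x" by (intro AE_I'[OF null]) auto
  show "M = return borel x"
  proof (rule measure_eqI)
    fix A assume A: "A \<in> sets M"
    show "emeasure M A = emeasure (return borel x) A"
    proof (cases "x \<in> A")
      case True
      have "emeasure M A = 1" using A AE True by (intro emeasure_eq_1_AE) auto
      with True A assms(2) show ?thesis by simp
    next
      case False
      then have "emeasure M A \<le> emeasure M (- {x})"
        using A assms(2) by (intro emeasure_mono) auto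
      with False A assms(2) 0 show ?thesis by simp
    qed
  qed (simp add: assms)
qed

text \<open>A law is Dirac iff two independent samples from it almost surely agree; unlike the
  definition, this condition involves no uncountable quantifier.\<close>

lemma sets_dirac_set:
  fixes KY :: "'b::topological_space \<Rightarrow> real measure"
  assumes KY: "KY \<in> borel \<rightarrow>\<^sub>M prob_algebra borel"
  shows "dirac_set KY \<in> sets borel"
proof -
  have [measurable]: "KY \<in> borel \<rightarrow>\<^sub>M subprob_algebra borel"
    using KY by (rule measurable_prob_algebraD)
  have K: "prob_space (KY y)" "sets (KY y) = sets borel" for y
    using measurable_space[OF KY, of y] by (auto simp: space_prob_algebra)
  \<comment> \<open>This is the probability that two independent samples from \<open>KY y\<close>
    differ.\<close>
  let ?F = "\<lambda>y. \<integral>\<^sup>+ x. emeasure (KY y) (- {x}) \<partial>KY y"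
  have m: "(\<lambda>p. emeasure (KY (fst p)) (- {snd p})) \<in> borel_measurable (borel \<Otimes>\<^sub>M borel)"
  proof (rule emeasure_measurable_subprob_algebra2[where N=borel])
    have "(SIGMA p:space (borel \<Otimes>\<^sub>M borel). - {snd p})
      = {q \<in> space (((borel :: 'b measure) \<Otimes>\<^sub>M borel) \<Otimes>\<^sub>M borel). snd (fst q) \<noteq> (snd q :: real)}"
      by (auto simp: space_pair_measure)
    also have "\<dots> \<in> sets ((borel \<Otimes>\<^sub>M borel) \<Otimes>\<^sub>M borel)" by measurable
    finally show "(SIGMA p:space ((borel :: 'b measure) \<Otimes>\<^sub>M borel). - {snd p :: real}) \<in> \<dots>" .
  qed measurable
  have [measurable]: "?F \<in> borel_measurable borel"
    by (rule nn_integral_measurable_subprob_algebra2[where N=borel])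
       (use m in \<open>simp_all add: case_prod_beta\<close>)
  have "y \<in> dirac_set KY \<longleftrightarrow> ?F y = 0" for y
  proof
    assume "y \<in> dirac_set KY"
    then obtain x where x: "KY y = return borel x" by (auto simp: dirac_set_def)
    have "?F y = (\<integral>\<^sup>+ z. indicator (- {x}) z \<partial>return borel x)"
      unfolding x by (intro nn_integral_cong) (auto simp: indicator_def)
    then show "?F y = 0" by simp
  next
    interpret prob_space "KY y" by (rule K)
    assume F: "?F y = 0"
    have "(\<lambda>x. emeasure (KY y) (- {x})) \<in> borel_measurable borel"
      using measurable_compose[OF _ m, of "\<lambda>x. (y, x)" borel] by simp
    then have "(\<lambda>x. emeasure (KY y) (- {x})) \<in> borel_measurable (KY y)"
      using K(2) by (simp cong: measurable_cong_sets)
    with F have "AE x in KY y. emeasure (KY y) (- {x}) = 0"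
      by (simp add: nn_integral_0_iff_AE)
    \<comment> \<open>A property that holds almost surely under a probability measure holds at some
      point.\<close>
    then obtain x where "emeasure (KY y) (- {x}) = 0"
      using eventually_happens ae_filter_bot by blast
    then show "y \<in> dirac_set KY"
      using prob_eq_return_iff[OF K] by (auto simp: dirac_set_def)
  qed
  then have "dirac_set KY = {y \<in> space borel. ?F y = 0}" by auto
  also have "\<dots> \<in> sets borel" by measurable
  finally show ?thesis .
qed

section \<open>Null rectangles seen through either kernel\<close>

text \<open>Both kernels integrate to the mass of the same rectangle, and an integral of a
  non-negative function vanishes iff the function does almost everywhere. Together the two parts
  carry null statements from one kernel to the other.\<close>

lemma disintegration_null_iff:
  fixes P :: "('a::second_countable_topology \<times> 'b::second_countable_topology) measure"
  assumes "disintegration P KX KY" and setsP: "sets P = sets borel"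
    and A: "A \<in> sets borel" and B: "B \<in> sets borel"
  shows "emeasure P (A \<times> B) = 0 \<longleftrightarrow> (AE x in distr P borel fst. x \<in> A \<longrightarrow> emeasure (KX x) B = 0)"
    and "emeasure P (A \<times> B) = 0 \<longleftrightarrow> (AE y in distr P borel snd. y \<in> B \<longrightarrow> emeasure (KY y) A = 0)"
proof -
  have KX: "KX \<in> borel \<rightarrow>\<^sub>M prob_algebra borel" and KY: "KY \<in> borel \<rightarrow>\<^sub>M prob_algebra borel"
    and dis: "\<And>E. E \<in> sets borel \<Longrightarrow>
        emeasure P E = (\<integral>\<^sup>+ x. emeasure (KX x) {y. (x, y) \<in> E} \<partial>distr P borel fst) \<and>
        emeasure P E = (\<integral>\<^sup>+ y. emeasure (KY y) {x. (x, y) \<in> E} \<partial>distr P borel snd)"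
    using assms(1) by (auto simp: disintegration_def)
  have [measurable]: "KX \<in> borel \<rightarrow>\<^sub>M subprob_algebra borel" "KY \<in> borel \<rightarrow>\<^sub>M subprob_algebra borel"
    using KX KY by (auto intro: measurable_prob_algebraD)
  note [measurable] = A B
  have AB: "A \<times> B \<in> sets borel" using A B by (rule borel_Times)
  have "emeasure P (A \<times> B) = (\<integral>\<^sup>+ x. emeasure (KX x) B * indicator A x \<partial>distr P borel fst)"
    unfolding dis[OF AB, THEN conjunct1] by (intro nn_integral_cong) (auto split: split_indicator)
  also have "\<dots> = 0 \<longleftrightarrow> (AE x in distr P borel fst. emeasure (KX x) B * indicator A x = 0)"
    by (rule nn_integral_0_iff_AE) measurable
  also have "\<dots> \<longleftrightarrow> (AE x in distr P borel fst. x \<in> A \<longrightarrow> emeasure (KX x) B = 0)"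
    by (auto simp: indicator_def cong: if_cong intro!: AE_cong)
  finally show "emeasure P (A \<times> B) = 0 \<longleftrightarrow>
    (AE x in distr P borel fst. x \<in> A \<longrightarrow> emeasure (KX x) B = 0)" .
  have "emeasure P (A \<times> B) = (\<integral>\<^sup>+ y. emeasure (KY y) A * indicator B y \<partial>distr P borel snd)"
    unfolding dis[OF AB, THEN conjunct2] by (intro nn_integral_cong) (auto split: split_indicator)
  also have "\<dots> = 0 \<longleftrightarrow> (AE y in distr P borel snd. emeasure (KY y) A * indicator B y = 0)"
    by (rule nn_integral_0_iff_AE) measurable
  also have "\<dots> \<longleftrightarrow> (AE y in distr P borel snd. y \<in> B \<longrightarrow> emeasure (KY y) A = 0)"
    by (auto simp: indicator_def cong: if_cong intro!: AE_cong)
  finally show "emeasure P (A \<times> B) = 0 \<longleftrightarrow>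
    (AE y in distr P borel snd. y \<in> B \<longrightarrow> emeasure (KY y) A = 0)" .
qed

section \<open>Support in cases (i) and (ii)\<close>

text \<open>An increment of the distribution function is the mass of a half-open interval, and such
  intervals just to the right of \<open>x\<close> lie in any given neighbourhood of
  \<open>x\<close>.\<close>

lemma interval_subset_support:
  assumes M: "real_distribution M" and mono: "strict_mono_on {a..b} (cdf M)"
  shows "{a<..<b} \<subseteq> support M"
proof
  interpret real_distribution M by fact
  fix x assume x: "x \<in> {a<..<b}"
  show "x \<in> support M"
    unfolding support_def
  proof (intro CollectI allI impI)
    fix U assume U: "open U \<and> x \<in> U"
    obtain e where e: "e > 0" "ball x e \<subseteq> U" using U by (meson openE)
    define d where "d = min (e / 2) (b - x)"
    have d: "0 < d" "x + d \<le> b" "d < e" using e x by (auto simp: d_def)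
    have sub: "{x<..x + d} \<subseteq> U" using e(2) d by (auto simp: dist_real_def subset_iff)
    have "cdf M x < cdf M (x + d)"
      using strict_mono_onD[OF mono, of x "x + d"] x d by auto
    then have "measure M {x<..x + d} > 0"
      using cdf_diff_eq[of x "x + d"] d by simp
    also have "measure M {x<..x + d} \<le> measure M U"
      using sub U by (intro finite_measure_mono) auto
    finally show "emeasure M U > 0" by (simp add: emeasure_eq_measure)
  qed
qed

text \<open>Otherwise \<open>\<gamma>\<close> would vanish on the support, which is null for
  \<open>\<eta>\<close>, and on its complement, which is null for \<open>M\<close>, hence
  everywhere.\<close>

lemma ac_support_pos:
  fixes M \<gamma> \<eta> :: "'a::second_countable_topology measure"
  assumes M: "sets M = sets borel" and \<eta>: "sets \<eta> = sets borel" and \<gamma>: "prob_space \<gamma>" "sets \<gamma> = sets borel"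
    and "absolutely_continuous M \<gamma>" "absolutely_continuous \<eta> \<gamma>"
  shows "emeasure \<eta> (support M) > 0"
proof (rule ccontr)
  interpret \<gamma>: prob_space \<gamma> by fact
  have S: "support M \<in> sets borel" by (rule borel_closed[OF closed_support])
  assume "\<not> ?thesis"
  then have "support M \<in> null_sets \<eta>" using S \<eta> by auto
  then have 1: "support M \<in> null_sets \<gamma>"
    using assms by (auto simp: absolutely_continuous_def)
  have "- support M \<in> null_sets M" using emeasure_Compl_support[OF M] S M by auto
  then have "- support M \<in> null_sets \<gamma>"
    using assms by (auto simp: absolutely_continuous_def)
  with 1 have "support M \<union> - support M \<in> null_sets \<gamma>" by (rule null_sets.Un)
  then have "emeasure \<gamma> (space \<gamma>) = 0"
    using sets_eq_imp_space_eq[OF \<gamma>(2)] by auto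
  with \<gamma>.emeasure_space_1 show False by simp
qed

theorem theorem2p8:
  fixes P :: "(real \<times> 'y::{banach, second_countable_topology}) measure"
    and \<mu> :: "real measure" and \<nu> :: "'y measure"
    and KX :: "real \<Rightarrow> 'y measure" and KY :: "'y \<Rightarrow> real measure"
    and D :: "'y set" and C :: "real set"
    and \<epsilon> :: real and \<eta> :: "real measure" and X :: "real set"
  assumes "prob_space P" and "sets P = sets borel"
    and "\<mu> = distr P borel fst" and "\<nu> = distr P borel snd"
    and "disintegration P KX KY"
    and "D = dirac_set KY" and "C = C_set \<mu> KX KY"
    and "\<epsilon> > 0"
    and "real_distribution \<eta>" and "diffuse \<eta>"
    and "countable (closure X)"
    and "AE y in \<nu>. y \<in> D_eps KY \<epsilon> \<inter> - D \<and> emeasure (KY y) C = 1 \<longrightarrow>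
           (\<exists>a b. a < b \<and> strict_mono_on {a..b} (cdf (KY y))) \<or>
           (\<exists>\<gamma>. real_distribution \<gamma> \<and> absolutely_continuous (KY y) \<gamma> \<and> absolutely_continuous \<eta> \<gamma>) \<or>
           (\<exists>x\<in>X. 0 < cdf (KY y) x \<and> cdf (KY y) x < 1)"
  shows "emeasure \<mu> C > 0 \<longrightarrow> \<not> R_plus \<mu> KX"
proof (intro impI notI)
  assume C_pos: "emeasure \<mu> C > 0" and R: "R_plus \<mu> KX"
  interpret P: prob_space P by fact
  interpret \<eta>: real_distribution \<eta> by fact
  have setsP: "sets P = sets borel" by fact
  have "fst \<in> P \<rightarrow>\<^sub>M borel" "snd \<in> P \<rightarrow>\<^sub>M borel"
    using setsP by (simp_all add: borel_prod[symmetric] cong: measurable_cong_sets)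
  then have "prob_space \<mu>" "prob_space \<nu>"
    unfolding assms(3,4) by (auto intro: P.prob_space_distr)
  then interpret \<mu>: prob_space \<mu> + \<nu>: prob_space \<nu> .
  have [measurable_cong]: "sets \<mu> = sets borel" "sets \<nu> = sets borel"
    by (simp_all add: assms(3,4))
  then have [simp]: "space \<mu> = UNIV" "space \<nu> = UNIV"
    by (metis sets_eq_imp_space_eq space_borel)+
  have KX: "KX \<in> borel \<rightarrow>\<^sub>M prob_algebra borel" and KY: "KY \<in> borel \<rightarrow>\<^sub>M prob_algebra borel"
    using assms(5) by (auto simp: disintegration_def)
  have K_subprob [measurable]: "KX \<in> borel \<rightarrow>\<^sub>M subprob_algebra borel" "KY \<in> borel \<rightarrow>\<^sub>M subprob_algebra borel"
    using KX KY by (auto intro: measurable_prob_algebraD)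
  have pX: "prob_space (KX x)" and sX [measurable_cong]: "sets (KX x) = sets borel" for x
    using measurable_space[OF KX, of x] by (auto simp: space_prob_algebra)
  have pY: "prob_space (KY y)" and sY [measurable_cong]: "sets (KY y) = sets borel" for y
    using measurable_space[OF KY, of y] by (auto simp: space_prob_algebra)
  have rY: "real_distribution (KY y)" for y
    using pY sY by (simp add: real_distribution_def real_distribution_axioms_def)
  note nullX = disintegration_null_iff(1)[OF assms(5) setsP, folded assms(3)]
  note nullY = disintegration_null_iff(2)[OF assms(5) setsP, folded assms(4)]
  have D [measurable]: "D \<in> sets borel"
    unfolding assms(6) by (rule sets_dirac_set[OF KY])
  have [measurable]: "(\<lambda>x. emeasure \<mu> {x}) \<in> borel_measurable borel"
  proof -
    have "(\<lambda>x. emeasure ((\<lambda>_. \<mu>) x) {x}) \<in> borel_measurable (borel :: real measure)"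
    proof (rule emeasure_measurable_subprob_algebra2[where N=borel])
      have "(SIGMA x:space borel. {x :: real}) = {q \<in> space (borel \<Otimes>\<^sub>M borel). fst q = snd q}"
        by (auto simp: space_pair_measure)
      also have "\<dots> \<in> sets (borel \<Otimes>\<^sub>M borel)" by measurable
      finally show "(SIGMA x:space borel. {x :: real}) \<in> \<dots>" .
      show "(\<lambda>_. \<mu>) \<in> borel \<rightarrow>\<^sub>M subprob_algebra borel"
        by (intro measurable_const)
           (simp add: space_subprob_algebra \<open>sets \<mu> = sets borel\<close> \<mu>.subprob_space_axioms)
    qed
    then show ?thesis .
  qed
  have "C = {x \<in> space borel. emeasure \<mu> {x} + emeasure (KX x) D = 0}"
    unfolding assms(6,7) C_set_def by simp
  also have "\<dots> \<in> sets borel" by measurable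
  finally have C [measurable]: "C \<in> sets borel" .
  have C_D: "emeasure \<mu> {x} = 0" "emeasure (KX x) D = 0" if "x \<in> C" for x
    using that unfolding assms(6,7) C_set_def by auto

  \<comment> \<open>An open set around the countable transversal and the rationals\<close>
  define H where "H = {p. fst p \<in> support (KY (snd p))}"
  have "H \<in> sets (borel \<Otimes>\<^sub>M borel)"
    using sets_graph_support[OF K_subprob(2)] by (simp add: H_def space_pair_measure)
  then have "H \<in> sets (\<eta> \<Otimes>\<^sub>M \<nu>)"
    using sets_pair_measure_cong[of \<eta> borel \<nu> borel] \<open>sets \<nu> = sets borel\<close> by simp
  with \<eta>.sigma_finite_measure_axioms \<nu>.finite_measure_axioms obtain \<Xi> where
    \<Xi>: "countable \<Xi>" and "AE y in \<nu>. emeasure \<eta> {x. (x, y) \<in> H} > 0 \<longrightarrow> (\<exists>x\<in>\<Xi>. (x, y) \<in> H)"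
    by (rule countable_transversal)
  then have hit: "AE y in \<nu>. emeasure \<eta> (support (KY y)) > 0 \<longrightarrow> (\<exists>x\<in>\<Xi>. x \<in> support (KY y))"
    by (simp add: H_def)

  define Q where "Q = \<Xi> \<union> \<rat>"
  have Q: "countable Q" using \<Xi> by (simp add: Q_def countable_rat)
  \<comment> \<open>Restricting \<open>\<mu>\<close> to \<open>C\<close> by a density keeps a finite
    Borel measure on the whole line, so outer regularity applies; \<open>Q\<close> is null for
    it.\<close>
  define \<mu>C where "\<mu>C = density \<mu> (indicator C)"
  have \<mu>C: "emeasure \<mu>C B = emeasure \<mu> (C \<inter> B)" if "B \<in> sets borel" for B
    using that unfolding \<mu>C_def
    by (subst emeasure_density) (auto simp: indicator_inter_arith[symmetric])
  have atomless: "emeasure \<mu> (C \<inter> B) = 0" if "countable B" for B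
  proof -
    have "(\<Union>x\<in>C \<inter> B. {x}) \<in> null_sets \<mu>"
      using that C_D(1) by (intro null_sets_UN') (auto simp: null_sets_def)
    then show ?thesis by auto
  qed
  have [measurable_cong]: "sets \<mu>C = sets borel" by (simp add: \<mu>C_def \<open>sets \<mu> = sets borel\<close>)
  have Q_sets: "Q \<in> sets borel" using Q by (rule sets.countable[rotated]) simp
  have "(INF U\<in>{U. Q \<subseteq> U \<and> open U}. emeasure \<mu>C U) = emeasure \<mu>C Q"
    using Q_sets \<mu>C[of UNIV] \<mu>.emeasure_finite[of C]
    by (intro outer_regular[symmetric]) (auto simp: \<mu>C_def \<open>sets \<mu> = sets borel\<close>)
  also have "\<dots> < emeasure \<mu> C"
    using \<mu>C[OF Q_sets] atomless[OF Q] C_pos by simp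
  finally obtain U where U: "Q \<subseteq> U" "open U" "emeasure \<mu>C U < emeasure \<mu> C"
    unfolding INF_less_iff by auto
  have [measurable]: "U \<in> sets borel" using U by simp
  have CU: "emeasure \<mu> (C - U) > 0"
  proof (rule ccontr)
    assume "\<not> ?thesis"
    then have "emeasure \<mu> (C - U) = 0" by simp
    moreover have "emeasure \<mu> (C \<inter> U) + emeasure \<mu> (C - U) = emeasure \<mu> (C \<inter> U \<union> (C - U))"
      by (intro plus_emeasure) auto
    then have "emeasure \<mu> C = emeasure \<mu> (C \<inter> U) + emeasure \<mu> (C - U)"
      by (simp only: Int_Diff_Un)
    ultimately show False using U(3) \<mu>C[of U] by simp
  qed

  \<comment> \<open>Localisation to a short interval that avoids \<open>X\<close>\<close>
  define J where "J = {(p, q). p \<in> \<rat> \<and> q \<in> \<rat> \<and> q - p \<le> \<epsilon> \<and> {p<..<q} \<inter> X = {}}"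
  have "countable J"
    by (rule countable_subset[of _ "\<rat> \<times> \<rat>"]) (auto simp: J_def countable_rat)
  have cover: "\<exists>(p, q)\<in>J. x \<in> {p<..<q}" if "x \<notin> closure X" for x
  proof -
    have "open (- closure X)" "x \<in> - closure X" using that by auto
    then obtain e where e: "e > 0" "ball x e \<subseteq> - closure X" by (meson openE)
    \<comment> \<open>The rational endpoints lie within \<open>d\<close> of \<open>x\<close>, so the
      interval is shorter than \<open>2 * d\<close>, which is at most
      \<open>\<epsilon>\<close>.\<close>
    define d where "d = min e (\<epsilon> / 2)"
    have d: "d > 0" "d \<le> e" "d \<le> \<epsilon> / 2" using e \<open>\<epsilon> > 0\<close> by (auto simp: d_def)
    obtain p where p: "p \<in> \<rat>" "x - d < p" "p < x" using Rats_dense_in_real[of "x - d" x] d by auto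
    obtain q where q: "q \<in> \<rat>" "x < q" "q < x + d" using Rats_dense_in_real[of x "x + d"] d by auto
    have "{p<..<q} \<subseteq> ball x e" using p q d by (auto simp: dist_real_def)
    with e(2) closure_subset[of X] have "{p<..<q} \<inter> X = {}" by blast
    with p q d show ?thesis by (intro bexI[of _ "(p, q)"]) (auto simp: J_def)
  qed
  \<comment> \<open>The intervals in \<open>J\<close> cover everything outside the countable set
    \<open>closure X\<close>, where \<open>\<mu>\<close> has no mass inside \<open>C\<close>. If all
    pieces were null, so would be \<open>C - U\<close>.\<close>
  have "\<exists>(p, q)\<in>J. emeasure \<mu> ((C - U) \<inter> {p<..<q}) > 0"
  proof (rule ccontr)
    assume "\<not> ?thesis"
    then have "(\<Union>(p, q)\<in>J. (C - U) \<inter> {p<..<q}) \<in> null_sets \<mu>"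
      by (intro null_sets_UN' \<open>countable J\<close>) (auto simp: null_sets_def)
    moreover have "C \<inter> closure X \<in> null_sets \<mu>"
      using atomless[OF assms(11)] by (auto simp: null_sets_def)
    ultimately have "(\<Union>(p, q)\<in>J. (C - U) \<inter> {p<..<q}) \<union> C \<inter> closure X \<in> null_sets \<mu>"
      by (rule null_sets.Un)
    moreover have "C - U \<subseteq> (\<Union>(p, q)\<in>J. (C - U) \<inter> {p<..<q}) \<union> C \<inter> closure X"
      using cover by fast
    moreover have "C - U \<in> sets \<mu>" by measurable
    ultimately have "C - U \<in> null_sets \<mu>" by (metis null_sets_subset)
    with CU show False by auto
  qed
  then obtain p q where pq: "q - p \<le> \<epsilon>" "{p<..<q} \<inter> X = {}"
    and A_pos': "emeasure \<mu> ((C - U) \<inter> {p<..<q}) > 0" by (auto simp: J_def)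
  define A where "A = (C - U) \<inter> {p<..<q}"
  have A [measurable]: "A \<in> sets borel" by (simp add: A_def)
  have A_pos: "emeasure \<mu> A > 0" using A_pos' by (simp add: A_def)

  \<comment> \<open>Contradiction from representing the indicator of \<open>A\<close>\<close>
  have "integrable \<mu> (indicator A :: real \<Rightarrow> real)"
    by (intro integrable_real_indicator) (auto simp: \<mu>.emeasure_eq_measure)
  then have "integrable \<mu> (indicator A :: real \<Rightarrow> real) \<and> (AE x in \<mu>. 0 \<le> (indicator A x :: real))"
    by simp
  from R[unfolded R_plus_def, rule_format, OF this] obtain g :: "'y \<Rightarrow> real"
    where g [measurable]: "g \<in> borel_measurable borel" and g0: "\<And>y. 0 \<le> g y"
      and gA: "AE x in \<mu>. ennreal (indicator A x) = (\<integral>\<^sup>+ y. ennreal (g y) \<partial>KX x)"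
    by auto
  define G where "G = {y. g y > 0}"
  have "G = {y \<in> space borel. g y > 0}" by (simp add: G_def)
  also have "\<dots> \<in> sets borel" by measurable
  finally have G [measurable]: "G \<in> sets borel" .
  have int0: "(\<integral>\<^sup>+ y. ennreal (g y) \<partial>KX x) = 0 \<longleftrightarrow> emeasure (KX x) G = 0" for x
  proof -
    have "(\<integral>\<^sup>+ y. ennreal (g y) \<partial>KX x) = 0 \<longleftrightarrow> (AE y in KX x. y \<notin> G)"
      using g0 by (subst nn_integral_0_iff_AE) (auto simp: G_def ennreal_eq_0_iff not_less)
    also have "\<dots> \<longleftrightarrow> emeasure (KX x) G = 0"
      by (subst AE_iff_null_sets[symmetric]) (auto simp: null_sets_def sX)
    finally show ?thesis .
  qed

  \<comment> \<open>Off \<open>A\<close> the integral of \<open>g\<close> vanishes, so the rectangle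
    \<open>- A \<times> G\<close> is null for \<open>P\<close>; read through \<open>KY\<close>,
    almost every \<open>y\<close> in \<open>G\<close> has its law carried by
    \<open>A\<close>.\<close>
  have "AE x in \<mu>. x \<in> - A \<longrightarrow> emeasure (KX x) G = 0"
    using gA
  proof (rule AE_mp, intro AE_I2 impI)
    fix x assume *: "ennreal (indicator A x) = (\<integral>\<^sup>+ y. ennreal (g y) \<partial>KX x)" and "x \<in> - A"
    then have "(\<integral>\<^sup>+ y. ennreal (g y) \<partial>KX x) = 0" by simp
    then show "emeasure (KX x) G = 0" using int0 by blast
  qed
  then have "AE y in \<nu>. y \<in> G \<longrightarrow> emeasure (KY y) (- A) = 0"
    using nullX[of "- A" G] nullY[of "- A" G] by auto
  with hit assms(12) have "AE y in \<nu>. y \<in> G \<longrightarrow> y \<in> D"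
  proof (eventually_elim, intro impI)
    fix y
    assume hit: "emeasure \<eta> (support (KY y)) > 0 \<longrightarrow> (\<exists>x\<in>\<Xi>. x \<in> support (KY y))"
      and alt: "y \<in> D_eps KY \<epsilon> \<inter> - D \<and> emeasure (KY y) C = 1 \<longrightarrow>
           (\<exists>a b. a < b \<and> strict_mono_on {a..b} (cdf (KY y))) \<or>
           (\<exists>\<gamma>. real_distribution \<gamma> \<and> absolutely_continuous (KY y) \<gamma> \<and> absolutely_continuous \<eta> \<gamma>) \<or>
           (\<exists>x\<in>X. 0 < cdf (KY y) x \<and> cdf (KY y) x < 1)"
      and "y \<in> G \<longrightarrow> emeasure (KY y) (- A) = 0" and "y \<in> G"
    then have Ac: "emeasure (KY y) (- A) = 0" by simp
    interpret Y: real_distribution "KY y" by (rule rY)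
    have zero: "emeasure (KY y) B = 0" if "B \<subseteq> - A" for B
      using emeasure_mono[OF that, of "KY y"] Ac sY by auto
    have AE_A: "AE x in KY y. x \<in> A"
      using Ac by (intro AE_I[of _ _ "- A"]) auto
    have one: "emeasure (KY y) B = 1" if "A \<subseteq> B" "B \<in> sets borel" for B
      using that AE_A by (intro Y.emeasure_eq_1_AE) auto
    show "y \<in> D"
    proof (rule ccontr)
      assume "y \<notin> D"
      moreover have "emeasure (KY y) C = 1" by (rule one) (auto simp: A_def)
      \<comment> \<open>The left endpoint \<open>p\<close> is the witness for \<open>D_eps\<close>,
        since \<open>A\<close> lies in an interval starting at \<open>p\<close> of length at most
        \<open>\<epsilon>\<close>.\<close>
      moreover have "emeasure (KY y) {p<..p + \<epsilon>} = 1"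
        using pq by (intro one) (auto simp: A_def)
      then have "y \<in> D_eps KY \<epsilon>" by (auto simp: D_eps_def)
      ultimately consider (i) a b where "a < b" "strict_mono_on {a..b} (cdf (KY y))"
        | (ii) \<gamma> where "real_distribution \<gamma>" "absolutely_continuous (KY y) \<gamma>" "absolutely_continuous \<eta> \<gamma>"
        | (iii) x where "x \<in> X" "0 < cdf (KY y) x" "cdf (KY y) x < 1"
        using alt by auto
      then have "\<exists>x\<in>Q. x \<in> support (KY y)"
      proof cases
        case i
        obtain r where r: "r \<in> \<rat>" "a < r" "r < b" using Rats_dense_in_real[OF i(1)] by blast
        then have "r \<in> support (KY y)" using interval_subset_support[OF rY i(2)] by auto
        with r show ?thesis by (auto simp: Q_def)
      next
        case ii
        then interpret \<gamma>: real_distribution \<gamma> by simp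
        have "emeasure \<eta> (support (KY y)) > 0"
          by (rule ac_support_pos[OF sY _ _ _ ii(2,3)]) (auto simp: \<gamma>.prob_space_axioms)
        with hit show ?thesis by (auto simp: Q_def)
      next
        case iii
        \<comment> \<open>A point of \<open>X\<close> lies on one side of \<open>A\<close>, so the
          distribution function there is 0 or 1, against (iii).\<close>
        have "x \<notin> {p<..<q}" using iii(1) pq(2) by auto
        then consider "q \<le> x" | "x \<le> p" by fastforce
        then show ?thesis
        proof cases
          case 1
          then have "emeasure (KY y) {..x} = 1" by (intro one) (auto simp: A_def)
          then show ?thesis using iii(3) by (simp add: cdf_def Y.emeasure_eq_measure)
        next
          case 2
          then have "emeasure (KY y) {..x} = 0" by (intro zero) (auto simp: A_def)
          then show ?thesis using iii(2) by (simp add: cdf_def Y.emeasure_eq_measure)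
        qed
      qed
      \<comment> \<open>A support point in the open set \<open>U\<close> forces positive mass on
        \<open>U\<close>, yet \<open>A\<close> is disjoint from \<open>U\<close>.\<close>
      then have "emeasure (KY y) U > 0" using U(1,2) by (auto simp: support_def)
      moreover have "emeasure (KY y) U = 0" by (rule zero) (auto simp: A_def)
      ultimately show False by simp
    qed
  qed
  \<comment> \<open>The transfer now runs backwards, from \<open>KY\<close> to \<open>KX\<close>. On
    \<open>A\<close> both \<open>G - D\<close> and \<open>D\<close> become null for
    \<open>KX x\<close>, so the integral of \<open>g\<close> is 0 where it should be 1.\<close>
  then have "emeasure P (A \<times> (G - D)) = 0"
    by (subst nullY) auto
  then have "AE x in \<mu>. x \<in> A \<longrightarrow> emeasure (KX x) (G - D) = 0"
    by (subst (asm) nullX) auto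
  with gA have "AE x in \<mu>. x \<notin> A"
  proof (eventually_elim, intro notI)
    fix x assume gx: "ennreal (indicator A x) = (\<integral>\<^sup>+ y. ennreal (g y) \<partial>KX x)"
      and GD: "x \<in> A \<longrightarrow> emeasure (KX x) (G - D) = 0" and xA: "x \<in> A"
    have "emeasure (KX x) G \<le> emeasure (KX x) ((G - D) \<union> D)"
      by (intro emeasure_mono) (auto simp: sX)
    also have "\<dots> \<le> emeasure (KX x) (G - D) + emeasure (KX x) D"
      by (intro emeasure_subadditive) (auto simp: sX)
    also have "\<dots> = 0" using GD xA C_D(2)[of x] by (auto simp: A_def)
    finally have "(\<integral>\<^sup>+ y. ennreal (g y) \<partial>KX x) = 0" using int0 by simp
    with gx xA show False by simp
  qed
  then have "emeasure \<mu> A = 0"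
    using AE_iff_null_sets[of A \<mu>] A \<open>sets \<mu> = sets borel\<close> by auto
  with A_pos show False by simp
qed

end
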